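(* Let $n\ge 1$ and let $A_n$ be the one-dimensional Clobber configuration consisting of $n$ stones on $n$ consecutive squares of a single row, with colors alternating black, white, black, white, $\dots$ (starting with a black stone). Then $A_n$ can be reduced to $\lceil n/4\rceil + [n\equiv 3 \pmod 4]$ stones by an alternating sequence of moves, no matter which color moves first. Here $[P]$ equals $1$ if $P$ holds and $0$ otherwise.
   Context: Clobber is played with black and white stones occupying some squares of a grid board. A move consists of picking up a stone and moving it onto a horizontally or vertically adjacent square occupied by a stone of the opposite color; that opposite-colored stone is removed ("clobbered") and replaced by the moved stone. In Solitaire Clobber, one performs an alternating sequence of moves, i.e., moves of white stones and moves of black stones alternate. A configuration is said to be reduced to $k$ stones if the sequence of moves ends in a configuration with exactly $k$ stones, none of which can move (no stone is horizontally or vertically adjacent to a stone of the opposite color). *)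

theory Defs
  imports Complex_Main
begin

datatype color = Black | White

fun opponent :: "color \<Rightarrow> color" where
  "opponent Black = White"
| "opponent White = Black"

type_synonym square = "int \<times> int"

(* None is an empty square.  The board is taken to be the whole grid: stones only ever
   move onto occupied squares, so its extent plays no role. *)
type_synonym config = "square \<Rightarrow> color option"

definition adjacent :: "square \<Rightarrow> square \<Rightarrow> bool" where
  "adjacent p q \<longleftrightarrow> \<bar>fst p - fst q\<bar> + \<bar>snd p - snd q\<bar> = 1"

inductive move :: "color \<Rightarrow> config \<Rightarrow> config \<Rightarrow> bool" where
  clobber: "C p = Some col \<Longrightarrow> C q = Some (opponent col) \<Longrightarrow> adjacent p q
    \<Longrightarrow> move col C (C(p := None, q := Some col))"

(* The color argument is the color making the first move, if there is one; the empty
   sequence of moves is alternating for either color. *)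
inductive alternating_moves :: "color \<Rightarrow> config \<Rightarrow> config \<Rightarrow> bool" where
  stop: "alternating_moves col C C"
| step: "move col C C' \<Longrightarrow> alternating_moves (opponent col) C' C''
    \<Longrightarrow> alternating_moves col C C''"

definition no_stone_can_move :: "config \<Rightarrow> bool" where
  "no_stone_can_move C \<longleftrightarrow>
    \<not> (\<exists>p q col. adjacent p q \<and> C p = Some col \<and> C q = Some (opponent col))"

definition reducible_to :: "color \<Rightarrow> config \<Rightarrow> nat \<Rightarrow> bool" where
  "reducible_to first C k \<longleftrightarrow>
    (\<exists>C'. alternating_moves first C C' \<and> no_stone_can_move C' \<and>
      finite (dom C') \<and> card (dom C') = k)"

definition alternating_row :: "nat \<Rightarrow> config" where
  "alternating_row n = (\<lambda>(x, y).
    if y = 0 \<and> 0 \<le> x \<and> x < int n then Some (if even x then Black else White) else None)"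

end

(*
  Cut the row into consecutive blocks of four stones and treat them from left to right.  A block
  BWBW can be reduced in three alternating moves, whoever starts, to a single stone on one of its
  two inner squares:
    Black first: BWBW -> _BBW -> _BW_ -> __B_      White first: BWBW -> BWW_ -> _BW_ -> _W__
  As the end squares of the block become empty, the stones left over from different blocks are
  never adjacent.  The at most three stones after the last full block are played out directly.
*)

theory Submission
  imports Defs
begin

text \<open>\<open>D\<close> collects the stones left over from blocks already played, and the part
  of the row still to be treated lies over it. Coloring by the parity of the column instead of the
  distance from \<open>a\<close> makes what remains after a block of four again such a row.\<close>

definition row_onto :: "config \<Rightarrow> int \<Rightarrow> nat \<Rightarrow> config" where
  "row_onto D a m = (\<lambda>(x, y).
    if y = 0 \<and> a \<le> x \<and> x < a + int m then Some (if even x then Black else White) else D (x, y))"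

text \<open>The \<open>+ 1\<close> keeps column \<open>a - 1\<close> empty too, so that no stone at
  column \<open>a\<close> or beyond can touch a stone of \<open>D\<close>.\<close>

definition left_of :: "config \<Rightarrow> int \<Rightarrow> bool" where
  "left_of D a \<longleftrightarrow> (\<forall>x y. a \<le> x + 1 \<longrightarrow> D (x, y) = None)"

lemma left_ofD: "left_of D a \<Longrightarrow> a \<le> x + 1 \<Longrightarrow> D (x, y) = None"
  by (simp add: left_of_def)

lemma left_of_upd: "left_of D a \<Longrightarrow> a \<le> b \<Longrightarrow> x + 1 < b \<Longrightarrow> left_of (D((x, y) \<mapsto> c)) b"
  by (auto simp: left_of_def)

lemma opponent_opponent [simp]: "opponent (opponent c) = c"
  by (cases c) auto

lemma opponent_neq [simp]: "c \<noteq> opponent c"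
  by (cases c) auto

lemma adjacent_sym: "adjacent p q \<Longrightarrow> adjacent q p"
  by (auto simp: adjacent_def)

lemma no_stone_can_move_upd:
  assumes "no_stone_can_move D" "\<And>q. adjacent p q \<Longrightarrow> D q \<noteq> Some (opponent c)"
  shows "no_stone_can_move (D(p \<mapsto> c))"
  using assms by (auto simp: no_stone_can_move_def split: if_splits dest: adjacent_sym)

lemma no_stone_can_move_upd_right:
  assumes "no_stone_can_move D" "left_of D a" "a \<le> x"
  shows "no_stone_can_move (D((x, y) \<mapsto> c))"
proof (rule no_stone_can_move_upd)
  fix q assume "adjacent (x, y) q"
  then have "D q = None"
    using left_ofD[OF assms(2), of "fst q" "snd q"] assms(3) by (simp add: adjacent_def)
  then show "D q \<noteq> Some (opponent c)" by simp
qed (rule assms)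

lemma alternating_clobber:
  assumes "C p = Some col" "C q = Some (opponent col)" "adjacent p q"
    "alternating_moves (opponent col) (C(p := None, q := Some col)) C'"
  shows "alternating_moves col C C'"
  using assms by (blast intro: alternating_moves.step move.clobber)

text \<open>Stated for an arbitrary continuation to \<open>C'\<close>, so that the three moves can
  be put in front of whatever sequence the rest of the row provides. Three is odd, hence the
  opponent is to move afterwards.\<close>

lemma alternating_block:
  assumes "even a" "left_of D a"
  obtains x c where "x = a + 1 \<or> x = a + 2"
    "\<And>C'. alternating_moves (opponent col) (row_onto (D((x, 0) \<mapsto> c)) (a + 4) m) C' \<Longrightarrow>
      alternating_moves col (row_onto D a (Suc (Suc (Suc (Suc m))))) C'"
proof (cases col)
  case Black
  let ?C = "row_onto D a (Suc (Suc (Suc (Suc m))))"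
  let ?C1 = "?C((a, 0) := None, (a + 1, 0) := Some Black)"
  let ?C2 = "?C1((a + 3, 0) := None, (a + 2, 0) := Some White)"
  let ?C3 = "?C2((a + 1, 0) := None, (a + 2, 0) := Some Black)"
  \<comment> \<open>The emptied squares agree with \<open>D\<close> because
    \<open>left_of D a\<close> makes \<open>D\<close> empty there.\<close>
  have eq: "?C3 = row_onto (D((a + 2, 0) \<mapsto> Black)) (a + 4) m"
    using assms by (auto simp: fun_eq_iff row_onto_def left_of_def)
  show thesis
  proof (rule that[of "a + 2" Black])
    fix C' assume "alternating_moves (opponent col) (row_onto (D((a + 2, 0) \<mapsto> Black)) (a + 4) m) C'"
    then have "alternating_moves White ?C3 C'" using Black eq by simp
    \<comment> \<open>\<open>alternating_clobber\<close> prepends a move, so the three moves are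
      added from last to first.\<close>
    then have "alternating_moves Black ?C2 C'"
      by (intro alternating_clobber[of ?C2 "(a + 1, 0)" _ "(a + 2, 0)"]) (auto simp: adjacent_def)
    then have "alternating_moves White ?C1 C'"
      using assms by (intro alternating_clobber[of ?C1 "(a + 3, 0)" _ "(a + 2, 0)"])
        (auto simp: adjacent_def row_onto_def)
    then have "alternating_moves Black ?C C'"
      using assms by (intro alternating_clobber[of ?C "(a, 0)" _ "(a + 1, 0)"])
        (auto simp: adjacent_def row_onto_def)
    then show "alternating_moves col ?C C'" using Black by simp
  qed simp
next
  case White
  let ?C = "row_onto D a (Suc (Suc (Suc (Suc m))))"
  let ?C1 = "?C((a + 3, 0) := None, (a + 2, 0) := Some White)"
  let ?C2 = "?C1((a, 0) := None, (a + 1, 0) := Some Black)"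
  let ?C3 = "?C2((a + 2, 0) := None, (a + 1, 0) := Some White)"
  have eq: "?C3 = row_onto (D((a + 1, 0) \<mapsto> White)) (a + 4) m"
    using assms by (auto simp: fun_eq_iff row_onto_def left_of_def)
  show thesis
  proof (rule that[of "a + 1" White])
    fix C' assume "alternating_moves (opponent col) (row_onto (D((a + 1, 0) \<mapsto> White)) (a + 4) m) C'"
    then have "alternating_moves Black ?C3 C'" using White eq by simp
    then have "alternating_moves White ?C2 C'"
      by (intro alternating_clobber[of ?C2 "(a + 2, 0)" _ "(a + 1, 0)"]) (auto simp: adjacent_def)
    then have "alternating_moves Black ?C1 C'"
      using assms by (intro alternating_clobber[of ?C1 "(a, 0)" _ "(a + 1, 0)"])
        (auto simp: adjacent_def row_onto_def)
    then have "alternating_moves White ?C C'"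
      using assms by (intro alternating_clobber[of ?C "(a + 3, 0)" _ "(a + 2, 0)"])
        (auto simp: adjacent_def row_onto_def)
    then show "alternating_moves col ?C C'" using White by simp
  qed simp
qed

lemma reducible_to_intro:
  "alternating_moves col C C' \<Longrightarrow> no_stone_can_move C' \<Longrightarrow> finite (dom C') \<Longrightarrow> card (dom C') = k
    \<Longrightarrow> reducible_to col C k"
  by (auto simp: reducible_to_def)

lemma alternating_one_move:
  "C p = Some col \<Longrightarrow> C q = Some (opponent col) \<Longrightarrow> adjacent p q
    \<Longrightarrow> C(p := None, q := Some col) = C' \<Longrightarrow> alternating_moves col C C'"
  by (blast intro: alternating_clobber alternating_moves.stop)

text \<open>The recursion mirrors the play, one stone per block and the remainder at the end, so
  that its induction rule yields the cases of the main induction.\<close>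

fun reduced_count :: "nat \<Rightarrow> nat" where
  "reduced_count 0 = 0"
| "reduced_count (Suc 0) = 1"
| "reduced_count (Suc (Suc 0)) = 1"
| "reduced_count (Suc (Suc (Suc 0))) = 2"
| "reduced_count (Suc (Suc (Suc (Suc m)))) = Suc (reduced_count m)"

text \<open>Each block adds a stone to \<open>D\<close>, shifts the start by four and passes the
  turn, so the induction has to generalize over \<open>D\<close>, \<open>a\<close> and
  \<open>col\<close>.\<close>

lemma reducible_row_onto:
  assumes "no_stone_can_move D" "left_of D a" "finite (dom D)" "even a"
  shows "reducible_to col (row_onto D a m) (card (dom D) + reduced_count m)"
  using assms
proof (induction m arbitrary: D a col rule: reduced_count.induct)
  case 1
  have "row_onto D a 0 = D" by (auto simp: row_onto_def fun_eq_iff)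
  then show ?case
    using 1 by (auto intro: reducible_to_intro alternating_moves.stop)
next
  case 2
  have "row_onto D a (Suc 0) = D((a, 0) \<mapsto> Black)"
    using \<open>even a\<close> by (auto simp: row_onto_def)
  then have "alternating_moves col (row_onto D a (Suc 0)) (D((a, 0) \<mapsto> Black))"
    by (metis alternating_moves.stop)
  moreover have "D (a, 0) = None" using 2 by (auto intro: left_ofD)
  ultimately show ?case
    using 2 by (elim reducible_to_intro) (auto intro: no_stone_can_move_upd_right simp: domIff)
next
  case 3
  \<comment> \<open>Black stands on \<open>a\<close> and White on \<open>a + 1\<close>; the mover
    ends on the other's square.\<close>
  let ?x = "if col = Black then a + 1 else a"
  have "alternating_moves col (row_onto D a (Suc (Suc 0))) (D((?x, 0) \<mapsto> col))"
  proof (cases col)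
    case Black
    then show ?thesis using 3
      by (intro alternating_one_move[of _ "(a, 0)" _ "(a + 1, 0)"])
        (auto simp: row_onto_def adjacent_def left_of_def fun_eq_iff)
  next
    case White
    then show ?thesis using 3
      by (intro alternating_one_move[of _ "(a + 1, 0)" _ "(a, 0)"])
        (auto simp: row_onto_def adjacent_def left_of_def fun_eq_iff)
  qed
  moreover have "D (?x, 0) = None" using 3 by (auto intro: left_ofD)
  ultimately show ?case
    using 3 by (elim reducible_to_intro) (auto intro: no_stone_can_move_upd_right simp: domIff)
next
  case 4
  \<comment> \<open>From BWB, a single move leaves _BB or W_B, and both are stuck with two
    stones.\<close>
  let ?x = "if col = Black then a + 1 else a"
  let ?D = "D((?x, 0) \<mapsto> col)"
  let ?E = "?D((a + 2, 0) \<mapsto> Black)"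
  have "alternating_moves col (row_onto D a (Suc (Suc (Suc 0)))) ?E"
  proof (cases col)
    case Black
    then show ?thesis using 4
      by (intro alternating_one_move[of _ "(a, 0)" _ "(a + 1, 0)"])
        (auto simp: row_onto_def adjacent_def left_of_def fun_eq_iff)
  next
    case White
    then show ?thesis using 4
      by (intro alternating_one_move[of _ "(a + 1, 0)" _ "(a, 0)"])
        (auto simp: row_onto_def adjacent_def left_of_def fun_eq_iff)
  qed
  \<comment> \<open>The stone on \<open>a + 2\<close> may have a neighbor on \<open>a + 1\<close>,
    but only if Black moved, and then both are black.\<close>
  moreover have "no_stone_can_move ?E"
  proof (rule no_stone_can_move_upd)
    show "no_stone_can_move ?D"
      by (rule no_stone_can_move_upd_right[OF 4(1,2)]) simp
    fix q assume adj: "adjacent (a + 2, 0) q"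
    then have "D q = None"
      using left_ofD[OF 4(2), of "fst q" "snd q"] by (simp add: adjacent_def)
    then show "?D q \<noteq> Some (opponent Black)"
      using adj by (cases col) (auto simp: adjacent_def)
  qed
  moreover have "D (?x, 0) = None" "D (a + 2, 0) = None" using 4 by (auto intro: left_ofD)
  then have "card (dom ?E) = card (dom D) + 2" using 4(3) by (simp add: domIff)
  ultimately show ?case
    using 4(3) by (elim reducible_to_intro) auto
next
  case (5 m)
  obtain x c where x: "x = a + 1 \<or> x = a + 2" and
    moves: "\<And>C'. alternating_moves (opponent col) (row_onto (D((x, 0) \<mapsto> c)) (a + 4) m) C' \<Longrightarrow>
      alternating_moves col (row_onto D a (Suc (Suc (Suc (Suc m))))) C'"
    using alternating_block[OF 5(5,3)] by metis
  let ?D = "D((x, 0) \<mapsto> c)"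
  have "reducible_to (opponent col) (row_onto ?D (a + 4) m) (card (dom ?D) + reduced_count m)"
  proof (rule "5.IH")
    show "no_stone_can_move ?D"
      using x by (intro no_stone_can_move_upd_right[OF 5(2,3)]) auto
    \<comment> \<open>The survivor is at column \<open>a + 2\<close> at most, so column
      \<open>a + 3\<close> remains as the gap.\<close>
    show "left_of ?D (a + 4)"
      using x by (intro left_of_upd[OF 5(3)]) auto
    show "finite (dom ?D)" "even (a + 4)"
      using 5(4,5) by simp_all
  qed
  moreover have "D (x, 0) = None" using x 5(3) by (auto intro: left_ofD)
  then have "card (dom ?D) = Suc (card (dom D))" using 5(4) by (simp add: domIff)
  ultimately show ?case
    using moves by (auto simp: reducible_to_def)
qed

text \<open>Four more stones raise the ceiling by exactly one and keep the residue modulo 4, so only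
  the values below 4 need computing.\<close>

lemma reduced_count_eq: "reduced_count n = nat \<lceil>real n / 4\<rceil> + of_bool (n mod 4 = 3)"
proof (induction n rule: reduced_count.induct)
  case (5 m)
  have "real (Suc (Suc (Suc (Suc m)))) / 4 = real m / 4 + 1" by simp
  then have "\<lceil>real (Suc (Suc (Suc (Suc m)))) / 4\<rceil> = \<lceil>real m / 4\<rceil> + 1" by linarith
  \<comment> \<open>Since \<open>nat\<close> truncates negative integers, it distributes over the
    sum only for nonnegative summands.\<close>
  moreover have "0 \<le> \<lceil>real m / 4\<rceil>" by (simp add: order_less_le_trans[of "-1" 0])
  moreover have "Suc (Suc (Suc (Suc m))) mod 4 = m mod 4" by presburger
  ultimately show ?case using 5 by (simp add: nat_add_distrib del: of_nat_Suc)
next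
  case 2
  have "\<lceil>1 / 4 :: real\<rceil> = 1" by (simp add: ceiling_eq_iff)
  then show ?case by simp
next
  case 3
  have "\<lceil>1 / 2 :: real\<rceil> = 1" by (simp add: ceiling_eq_iff)
  then show ?case by simp
next
  case 4
  have "\<lceil>3 / 4 :: real\<rceil> = 1" by (simp add: ceiling_eq_iff)
  then show ?case by simp
qed simp

theorem theorem1:
  fixes n :: nat
  assumes "n \<ge> 1"
  shows "\<forall>first. reducible_to first (alternating_row n)
    (nat \<lceil>real n / 4\<rceil> + of_bool (n mod 4 = 3))"
proof
  fix first
  have "alternating_row n = row_onto Map.empty 0 n"
    by (auto simp: alternating_row_def row_onto_def)
  moreover have "reducible_to first (row_onto Map.empty 0 n)
      (card (dom (Map.empty :: config)) + reduced_count n)"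
    by (rule reducible_row_onto) (auto simp: no_stone_can_move_def left_of_def)
  ultimately show "reducible_to first (alternating_row n)
      (nat \<lceil>real n / 4\<rceil> + of_bool (n mod 4 = 3))"
    by (simp add: reduced_count_eq)
qed

end
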